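(* Let $p$ be an odd prime with $p\equiv 2\pmod 3$. Then for $M=(2p-1)/3$ and also for $M=p-1$, $$\sum_{k=0}^{M}(-1)^k(6k+1)\frac{(\frac13)_k^3}{k!^3}\equiv -2p+\frac{8p^3}{9}E_{p-3}\left(\tfrac13\right)\pmod{p^4}.$$
   Context: $(x)_k=x(x+1)\cdots(x+k-1)$ is the Pochhammer symbol, with $(x)_0=1$. The Euler polynomials $E_n(x)$ are defined by $\sum_{n\ge 0}E_n(x)\frac{t^n}{n!}=\frac{2e^{xt}}{e^t+1}$. A congruence modulo $p^4$ between rational numbers whose denominators are prime to $p$ means that the difference lies in $p^4\mathbb{Z}_p$, where $\mathbb{Z}_p$ is the ring of $p$-adic integers. *)

theory Defs
  imports "HOL-Computational_Algebra.Computational_Algebra" "HOL-Number_Theory.Cong"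
begin

(* The value E_n(x) of the n-th Euler polynomial: n! times the coefficient of t^n in
   2 e^(x t) / (e^t + 1).  The quotient is the genuine one, because the constant term
   of the denominator is 2; see euler_poly_generating_function. *)
definition euler_poly :: "nat \<Rightarrow> 'a \<Rightarrow> 'a::field_char_0" where
  "euler_poly n x = fact n * fps_nth (2 * fps_exp x / (fps_exp 1 + 1)) n"

lemma euler_poly_generating_function:
  fixes x :: "'a::field_char_0"
  shows "Abs_fps (\<lambda>n. euler_poly n x / fact n) * (fps_exp 1 + 1) = 2 * fps_exp x"
proof -
  have nz: "fps_nth (fps_exp 1 + 1 :: 'a fps) 0 \<noteq> 0"
    by simp
  have "Abs_fps (\<lambda>n. euler_poly n x / fact n) = 2 * fps_exp x / (fps_exp 1 + 1)"
    by (simp add: fps_eq_iff euler_poly_def)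
  then show ?thesis
    using nz by (simp add: fps_divide_unit mult.assoc inverse_mult_eq_1)
qed

(* The rational numbers that are p-adic integers, i.e. the intersection of Q and Z_p:
   quotient_of yields the numerator and the (positive) denominator in lowest terms. *)
definition padic_integral_rats :: "nat \<Rightarrow> rat set" where
  "padic_integral_rats p = {x. coprime (snd (quotient_of x)) (int p)}"

(* Congruence modulo p^m of rationals with denominators prime to p.  A rational lies in
   p^m Z_p iff it is p^m times a rational p-adic integer. *)
definition rat_cong_ppow :: "nat \<Rightarrow> nat \<Rightarrow> rat \<Rightarrow> rat \<Rightarrow> bool" where
  "rat_cong_ppow p m a b \<longleftrightarrow>
     a \<in> padic_integral_rats p \<and> b \<in> padic_integral_rats p \<and>
     (\<exists>z \<in> padic_integral_rats p. a - b = of_nat p ^ m * z)"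

end

theory Submission
  imports Defs "HOL-Number_Theory.Residues"
begin

text \<open>
  Put \<open>t(a, k) = (-1)\<^sup>k (2k + a) ((a)\<^sub>k / k!)\<^sup>3\<close>, so that the sum in question is \<open>3 \<Sum>\<^sub>k t(1/3, k)\<close>,
  and let \<open>u = 2p/3\<close>, \<open>n = (2p - 1)/3\<close>; then \<open>1/3 = u - n\<close> and \<open>n\<close> is odd.
  A Wilf--Zeilberger identity sums \<open>t(a, k) + t(a + 1, k)\<close> over \<open>k\<close> in closed form.  Hence the truncated sums
  \<open>P\<^sub>m = \<Sum>\<^sub>k t(u - m, k)\<close>, with \<open>k \<le> m\<close> or with \<open>k \<le> p - 1\<close>, satisfy
  \<open>P\<^sub>m + P\<^bsub>m-1\<^esub> \<equiv> 2u\<^sup>3/m\<^sup>2 (mod p\<^sup>4)\<close> for \<open>0 < m < p\<close>, and \<open>P\<^sub>0 \<equiv> u\<close>.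
  By Fermat \<open>E\<^bsub>p-3\<^esub>(u - m)\<close> satisfies the same recurrence modulo \<open>p\<close> up to the factor \<open>u\<^sup>3\<close>, and
  \<open>E\<^bsub>p-3\<^esub>(u) \<equiv> E\<^bsub>p-3\<^esub>(0) = 0\<close>.  So \<open>P\<^sub>m \<equiv> (-1)\<^sup>m u + u\<^sup>3 E\<^bsub>p-3\<^esub>(u - m)\<close>; take \<open>m = n\<close>.
\<close>

declare One_nat_def [simp del]

subsection \<open>Rational \<open>p\<close>-adic integers\<close>

locale rat_padic =
  fixes p :: nat
  assumes prime_p: "prime p"
begin

abbreviation Zp :: "rat set" where "Zp \<equiv> padic_integral_rats p"

text \<open>The reduced denominator divides every other denominator of \<open>x\<close>, so any
  fraction with denominator prime to \<open>p\<close> will do. This makes the closure properties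
  below short.\<close>

lemma mem_Zp_iff: "x \<in> Zp \<longleftrightarrow> (\<exists>a b. \<not> int p dvd b \<and> x = of_int a / of_int b)"
proof
  assume "x \<in> Zp"
  then have "coprime (snd (quotient_of x)) (int p)"
    by (simp add: padic_integral_rats_def)
  then have "\<not> int p dvd snd (quotient_of x)"
    using prime_p by (metis coprime_common_divisor dvd_refl not_prime_unit prime_nat_int_transfer)
  then show "\<exists>a b. \<not> int p dvd b \<and> x = of_int a / of_int b"
    by (metis prod.collapse quotient_of_div)
next
  assume "\<exists>a b. \<not> int p dvd b \<and> x = of_int a / of_int b"
  then obtain a b where b: "\<not> int p dvd b" and x: "x = of_int a / of_int b"
    by blast
  obtain c d where q: "quotient_of x = (c, d)"
    by force
  then have d: "d > 0" and cop: "coprime c d" and xd: "x = of_int c / of_int d"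
    by (auto simp: quotient_of_denom_pos quotient_of_coprime quotient_of_div)
  have "b \<noteq> 0" using b by auto
  have "of_int (a * d) = (of_int (c * b) :: rat)"
    using x xd d \<open>b \<noteq> 0\<close> by (simp add: field_simps)
  then have "a * d = c * b"
    by (simp only: of_int_eq_iff)
  then have "d dvd b"
    using cop by (metis coprime_commute coprime_dvd_mult_right_iff dvd_triv_right)
  then have "\<not> int p dvd d"
    using b dvd_trans by blast
  then show "x \<in> Zp"
    using prime_p q prime_imp_coprime[of "int p" d] by (simp add: padic_integral_rats_def coprime_commute)
qed

lemma Zp_of_int [simp, intro]: "of_int a \<in> Zp"
  unfolding mem_Zp_iff using prime_p
  by (intro exI[of _ a] exI[of _ 1]) (auto simp: prime_gt_1_nat)

lemma Zp_0 [simp, intro]: "0 \<in> Zp" and Zp_1 [simp, intro]: "1 \<in> Zp"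
  and Zp_of_nat [simp, intro]: "of_nat k \<in> Zp" and Zp_numeral [simp, intro]: "numeral w \<in> Zp"
  using Zp_of_int[of 0] Zp_of_int[of 1] Zp_of_int[of "int k"] Zp_of_int[of "numeral w"] by simp_all

lemma Zp_add [intro]: "x \<in> Zp \<Longrightarrow> y \<in> Zp \<Longrightarrow> x + y \<in> Zp"
proof -
  assume "x \<in> Zp" "y \<in> Zp"
  then obtain a b c d where *: "\<not> int p dvd b" "x = of_int a / of_int b"
      "\<not> int p dvd d" "y = of_int c / of_int d"
    unfolding mem_Zp_iff by blast
  then have "\<not> int p dvd b * d" "b \<noteq> 0" "d \<noteq> 0"
    using prime_p by (auto simp: prime_dvd_mult_iff)
  moreover have "x + y = of_int (a * d + c * b) / of_int (b * d)"
    using * calculation by (simp add: field_simps)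
  ultimately show ?thesis unfolding mem_Zp_iff by blast
qed

lemma Zp_mult [intro]: "x \<in> Zp \<Longrightarrow> y \<in> Zp \<Longrightarrow> x * y \<in> Zp"
proof -
  assume "x \<in> Zp" "y \<in> Zp"
  then obtain a b c d where *: "\<not> int p dvd b" "x = of_int a / of_int b"
      "\<not> int p dvd d" "y = of_int c / of_int d"
    unfolding mem_Zp_iff by blast
  then have "\<not> int p dvd b * d"
    using prime_p by (auto simp: prime_dvd_mult_iff)
  moreover have "x * y = of_int (a * c) / of_int (b * d)"
    using * by simp
  ultimately show ?thesis unfolding mem_Zp_iff by blast
qed

lemma Zp_uminus [intro]: "x \<in> Zp \<Longrightarrow> - x \<in> Zp"
  using Zp_mult[OF Zp_of_int[of "-1"]] by simp

lemma Zp_diff [intro]: "x \<in> Zp \<Longrightarrow> y \<in> Zp \<Longrightarrow> x - y \<in> Zp"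
  using Zp_add[OF _ Zp_uminus] by simp

lemma Zp_power [intro]: "x \<in> Zp \<Longrightarrow> x ^ k \<in> Zp"
  by (induction k) auto

lemma Zp_sum [intro]: "(\<And>i. i \<in> A \<Longrightarrow> f i \<in> Zp) \<Longrightarrow> sum f A \<in> Zp"
  by (induction A rule: infinite_finite_induct) auto

text \<open>Only the difference is constrained, so sums and transitivity need no integrality of the
  two sides; products ask for it separately.\<close>

definition pcong :: "nat \<Rightarrow> rat \<Rightarrow> rat \<Rightarrow> bool" where
  "pcong m x y \<longleftrightarrow> (\<exists>z\<in>Zp. x - y = of_nat p ^ m * z)"

lemma pcong_refl [simp, intro]: "pcong m x x"
  unfolding pcong_def by (rule bexI[of _ 0]) auto

lemma pcong_diff_0_iff: "pcong m x y \<longleftrightarrow> pcong m (x - y) 0"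
  by (simp add: pcong_def)

lemma pcong_uminus: "pcong m x y \<Longrightarrow> pcong m (- x) (- y)"
  unfolding pcong_def by (metis Zp_uminus minus_diff_minus mult_minus_right)

lemma pcong_sym: "pcong m x y \<Longrightarrow> pcong m y x"
  unfolding pcong_def by (metis Zp_uminus minus_diff_eq mult_minus_right)

lemma pcong_add: "pcong m x y \<Longrightarrow> pcong m z w \<Longrightarrow> pcong m (x + z) (y + w)"
  unfolding pcong_def by (metis Zp_add add_diff_add distrib_left)

lemma pcong_diff: "pcong m x y \<Longrightarrow> pcong m z w \<Longrightarrow> pcong m (x - z) (y - w)"
  using pcong_add[OF _ pcong_uminus] by fastforce

lemma pcong_trans [trans]: "pcong m x y \<Longrightarrow> pcong m y z \<Longrightarrow> pcong m x z"
  using pcong_add[of m "x" y "y" z] pcong_diff_0_iff[of m "x + y" "y + z"] pcong_diff_0_iff[of m x z]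
  by (simp add: algebra_simps)

lemma pcong_sum: "(\<And>i. i \<in> A \<Longrightarrow> pcong m (f i) (g i)) \<Longrightarrow> pcong m (sum f A) (sum g A)"
  by (induction A rule: infinite_finite_induct) (auto intro: pcong_add)

lemma pcong_mult_left: "c \<in> Zp \<Longrightarrow> pcong m x y \<Longrightarrow> pcong m (c * x) (c * y)"
  unfolding pcong_def by (metis Zp_mult mult.left_commute right_diff_distrib)

lemma pcong_mult_right: "c \<in> Zp \<Longrightarrow> pcong m x y \<Longrightarrow> pcong m (x * c) (y * c)"
  using pcong_mult_left by (simp add: mult.commute)

lemma pcong_Zp: "pcong m x y \<Longrightarrow> y \<in> Zp \<Longrightarrow> x \<in> Zp"
  unfolding pcong_def by (metis Zp_add Zp_mult Zp_of_nat Zp_power diff_add_cancel)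

text \<open>Integrality is demanded only on the right, where the simpler explicit expressions stand;
  by \<open>pcong_Zp\<close> it passes to the left.\<close>

lemma pcong_mult:
  assumes "pcong m x y" "pcong m z w" "y \<in> Zp" "w \<in> Zp"
  shows "pcong m (x * z) (y * w)"
proof -
  have "z \<in> Zp" using assms pcong_Zp by blast
  then show ?thesis
    using pcong_mult_right[of z m x y] pcong_mult_left[of y m z w] assms pcong_trans by blast
qed

lemma pcong_power: "pcong m x y \<Longrightarrow> y \<in> Zp \<Longrightarrow> pcong m (x ^ k) (y ^ k)"
  by (induction k) (auto intro: pcong_mult)

lemma pcong_raise:
  assumes "pcong m x y" shows "pcong (j + m) (of_nat p ^ j * x) (of_nat p ^ j * y)"
  using assms unfolding pcong_def by (auto simp: power_add mult.assoc simp flip: right_diff_distrib)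

lemma pcong_p [simp, intro]: "pcong 1 (of_nat p) 0"
  unfolding pcong_def by (rule bexI[of _ 1]) auto

lemma pcong_of_int_0_iff: "pcong 1 (of_int a) 0 \<longleftrightarrow> int p dvd a"
proof
  assume "pcong 1 (of_int a) 0"
  then obtain z where "z \<in> Zp" and z: "(of_int a :: rat) = of_nat p * z"
    unfolding pcong_def by auto
  then obtain c b where b: "\<not> int p dvd b" and "z = of_int c / of_int b"
    unfolding mem_Zp_iff by blast
  with z have e: "(of_int a :: rat) = of_nat p * (of_int c / of_int b)"
    by simp
  have "b \<noteq> 0" using b by auto
  then have "(of_int (a * b) :: rat) = of_int (int p * c)"
    using e by (simp add: field_simps)
  then have "a * b = int p * c" by (simp only: of_int_eq_iff)
  then have "int p dvd a * b" by simp
  then show "int p dvd a" using b prime_p by (simp add: prime_dvd_mult_iff)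
next
  assume "int p dvd a"
  then obtain k where "a = int p * k" by blast
  then have "of_int a - 0 = of_nat p ^ 1 * (of_int k :: rat)" by simp
  then show "pcong 1 (of_int a) 0" unfolding pcong_def by blast
qed

lemma pcong_of_int:
  assumes "[a = b] (mod int p)" shows "pcong 1 (of_int a) (of_int b)"
  using assms pcong_of_int_0_iff[of "a - b"] pcong_diff_0_iff[of 1 "of_int a" "of_int b"]
  by (simp add: cong_iff_dvd_diff)

lemma not_pcong_0_of_nat: "0 < k \<Longrightarrow> k < p \<Longrightarrow> \<not> pcong 1 (of_nat k) 0"
  using pcong_of_int_0_iff[of "int k"] by (auto dest: nat_dvd_not_less simp flip: of_nat_dvd_iff)

text \<open>Among \<open>p\<close>-integral rationals, \<open>\<not> pcong 1 x 0\<close> says that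
  \<open>x\<close> is a \<open>p\<close>-adic unit: the numerator is prime to \<open>p\<close> as
  well.\<close>

lemma Zp_inverse:
  assumes "x \<in> Zp" "\<not> pcong 1 x 0" shows "inverse x \<in> Zp"
proof -
  obtain a b where b: "\<not> int p dvd b" and x: "x = of_int a / of_int b"
    using assms(1) unfolding mem_Zp_iff by blast
  have "\<not> int p dvd a"
  proof
    assume "int p dvd a"
    then obtain k where "a = int p * k" by blast
    then have "x - 0 = of_nat p ^ 1 * (of_int k / of_int b)" using x by simp
    moreover have "of_int k / of_int b \<in> Zp" using b unfolding mem_Zp_iff by blast
    ultimately show False using assms(2) unfolding pcong_def by blast
  qed
  moreover have "inverse x = of_int b / of_int a" using x by simp
  ultimately show ?thesis unfolding mem_Zp_iff by blast
qed

lemma pcong_inverse: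
  assumes "pcong 1 x y" "y \<in> Zp" "\<not> pcong 1 y 0"
  shows "pcong 1 (inverse x) (inverse y)"
proof -
  have x: "x \<in> Zp" "\<not> pcong 1 x 0"
    using pcong_Zp[OF assms(1,2)] pcong_trans[OF pcong_sym[OF assms(1)]] assms(3) by auto
  then have nz: "x \<noteq> 0" "y \<noteq> 0" using assms by auto
  \<comment> \<open>Multiply \<open>y \<equiv> x\<close> by the \<open>p\<close>-adic integer
    \<open>1/(xy)\<close>.\<close>
  have "pcong 1 (inverse x * inverse y * y) (inverse x * inverse y * x)"
    using assms x by (intro pcong_mult_left[OF _ pcong_sym] Zp_mult Zp_inverse)
  then show ?thesis using nz by (simp add: field_simps)
qed

lemma Zp_divide: "x \<in> Zp \<Longrightarrow> y \<in> Zp \<Longrightarrow> \<not> pcong 1 y 0 \<Longrightarrow> x / y \<in> Zp"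
  by (simp add: divide_inverse Zp_inverse Zp_mult)

lemma pcong_divide:
  assumes "pcong 1 x y" "pcong 1 z w" "y \<in> Zp" "w \<in> Zp" "\<not> pcong 1 w 0"
  shows "pcong 1 (x / z) (y / w)"
  unfolding divide_inverse using assms by (intro pcong_mult pcong_inverse Zp_inverse) auto

lemma pcong_pochhammer:
  assumes "pcong m x y" "y \<in> Zp"
  shows "pcong m (pochhammer x k) (pochhammer y k)" "pochhammer y k \<in> Zp"
proof (induction k)
  case (Suc k)
  { case 1
    show ?case unfolding pochhammer_Suc
      using Suc assms by (intro pcong_mult pcong_add) auto }
  { case 2
    show ?case unfolding pochhammer_Suc using Suc assms by auto }
qed auto

lemma Zp_fact [simp, intro]: "fact k \<in> Zp"
  using Zp_of_nat[of "fact k"] by (simp del: Zp_of_nat)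

lemma not_pcong_0_fact: "k < p \<Longrightarrow> \<not> pcong 1 (fact k) 0"
  using pcong_of_int_0_iff[of "fact k"] prime_dvd_fact_iff[OF prime_p, of k]
  by (metis int_dvd_int_iff not_less of_int_fact of_nat_fact)

text \<open>Fermat's \<open>m^(p-1) \<equiv> 1\<close> divided by \<open>m^2\<close>. It matches the
  powers in the Euler recurrence with the inverse squares from telescoping.\<close>

lemma fermat_inverse_square:
  assumes "0 < m" "m < p" "3 \<le> p"
  shows "pcong 1 (of_nat m ^ (p - 3)) (1 / of_nat m ^ 2)"
proof -
  have "\<not> p dvd m" using assms by (auto dest: nat_dvd_not_less)
  then have "[m ^ (p - 1) = 1] (mod p)" using fermat_theorem prime_p by blast
  then have "pcong 1 (of_nat m ^ (p - 1)) 1"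
    using pcong_of_int[of "int (m ^ (p - 1))" "int 1"] by (simp flip: cong_int_iff)
  moreover have "p - 1 = (p - 3) + 2" using assms by simp
  then have "(of_nat m :: rat) ^ (p - 1) = of_nat m ^ (p - 3) * of_nat m ^ 2"
    by (simp only: power_add)
  moreover have "inverse (of_nat m) ^ 2 \<in> Zp"
    using assms by (intro Zp_power Zp_inverse not_pcong_0_of_nat) auto
  ultimately have "pcong 1 (inverse (of_nat m) ^ 2 * (of_nat m ^ (p - 3) * of_nat m ^ 2))
      (inverse (of_nat m) ^ 2 * 1)"
    using pcong_mult_left by metis
  then show ?thesis using assms by (simp add: field_simps)
qed

text \<open>Under \<open>k \<mapsto> p - k\<close> the sign flips, \<open>p\<close> being odd, while
  \<open>1/k^2\<close> is unchanged modulo \<open>p\<close>. The sum is thus congruent to its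
  negative, and 2 is invertible.\<close>

lemma alternating_inverse_square_sum:
  assumes "odd p"
  shows "pcong 1 (\<Sum>k\<in>{0<..<p}. (-1) ^ k / of_nat k ^ 2) 0"
proof -
  define f :: "nat \<Rightarrow> rat" where "f k = (-1) ^ k / of_nat k ^ 2" for k
  have fZ: "f k \<in> Zp" if "k \<in> {0<..<p}" for k
    unfolding f_def divide_inverse power_inverse[symmetric]
    using that by (intro Zp_mult Zp_power Zp_inverse not_pcong_0_of_nat) auto
  have neg: "pcong 1 (f (p - k)) (- f k)" if k: "k \<in> {0<..<p}" for k
  proof -
    have "(-1::rat) ^ (p - k) = - ((-1) ^ k)"
      using assms k by (cases "even k") auto
    moreover have "pcong 1 (of_nat p - of_nat k) (0 - of_nat k)"
      by (intro pcong_diff) auto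
    then have "pcong 1 (inverse (of_nat (p - k)) ^ 2) (inverse (- of_nat k) ^ 2)"
      using k pcong_uminus[of 1 "- of_nat k" 0] not_pcong_0_of_nat[of k]
      by (intro pcong_power pcong_inverse Zp_inverse) (auto simp: of_nat_diff)
    then have "pcong 1 (- ((-1) ^ k) * inverse (of_nat (p - k)) ^ 2) (- ((-1) ^ k) * inverse (- of_nat k) ^ 2)"
      by (intro pcong_mult_left) auto
    ultimately show ?thesis by (simp add: f_def divide_inverse power_inverse)
  qed
  have "2 < p" using assms prime_ge_2_nat[OF prime_p] by (cases "p = 2") auto
  have "(\<Sum>k\<in>{0<..<p}. f (p - k)) = (\<Sum>k\<in>{0<..<p}. f k)"
    by (rule sum.reindex_bij_witness[of _ "\<lambda>k. p - k" "\<lambda>k. p - k"]) auto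
  moreover have "pcong 1 (\<Sum>k\<in>{0<..<p}. f (p - k)) (\<Sum>k\<in>{0<..<p}. - f k)"
    using neg by (intro pcong_sum) auto
  ultimately have "pcong 1 (sum f {0<..<p}) (- sum f {0<..<p})"
    by (simp add: sum_negf)
  then have "pcong 1 (sum f {0<..<p} + sum f {0<..<p}) (- sum f {0<..<p} + sum f {0<..<p})"
    by (intro pcong_add) auto
  then have "pcong 1 (2 * sum f {0<..<p}) 0"
    by (simp only: mult_2 add.left_inverse)
  moreover have "inverse 2 \<in> Zp"
    using not_pcong_0_of_nat[of 2] \<open>2 < p\<close> by (intro Zp_inverse) simp_all
  ultimately have "pcong 1 (inverse 2 * (2 * sum f {0<..<p})) (inverse 2 * 0)"
    by (rule pcong_mult_left[rotated])
  then show ?thesis by (simp add: f_def)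
qed

end

subsection \<open>Euler polynomials\<close>

lemma euler_poly_add:
  fixes x y :: "'a::field_char_0"
  shows "euler_poly n (x + y) = (\<Sum>k\<le>n. of_nat (n choose k) * euler_poly k x * y ^ (n - k))"
proof -
  have e: "(2 * fps_exp (x + y) / (fps_exp 1 + 1) :: 'a fps)
      = 2 * fps_exp x / (fps_exp 1 + 1) * fps_exp y"
    by (simp add: fps_exp_add_mult fps_divide_unit mult_ac)
  have "euler_poly n (x + y)
      = (\<Sum>k\<le>n. fact n * ((2 * fps_exp x / (fps_exp 1 + 1)) $ k * (y ^ (n - k) / fact (n - k))))"
    unfolding euler_poly_def e
    by (simp add: fps_mult_nth sum_distrib_left atLeast0AtMost)
  also have "\<dots> = (\<Sum>k\<le>n. of_nat (n choose k) * euler_poly k x * y ^ (n - k))"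
    by (intro sum.cong refl) (simp add: euler_poly_def binomial_fact field_simps)
  finally show ?thesis .
qed

text \<open>Adding the generating functions for \<open>x + 1\<close> and \<open>x\<close> produces
  the factor \<open>e^t + 1\<close>, which cancels the denominator.\<close>

lemma euler_poly_plus_1:
  fixes x :: "'a::field_char_0"
  shows "euler_poly n (x + 1) + euler_poly n x = 2 * x ^ n"
proof -
  have "(2 * fps_exp (x + 1) / (fps_exp 1 + 1) + 2 * fps_exp x / (fps_exp 1 + 1) :: 'a fps)
      = 2 * fps_exp x * ((fps_exp 1 + 1) * inverse (fps_exp 1 + 1))"
    by (simp add: fps_exp_add_mult fps_divide_unit algebra_simps)
  also have "\<dots> = 2 * fps_exp x"
    by (simp add: inverse_mult_eq_1')
  finally have "(2 * fps_exp (x + 1) / (fps_exp 1 + 1)) $ n + (2 * fps_exp x / (fps_exp 1 + 1)) $ n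
      = (2 * fps_exp x :: 'a fps) $ n"
    by (metis fps_add_nth)
  then have "fact n * ((2 * fps_exp (x + 1) / (fps_exp 1 + 1)) $ n + (2 * fps_exp x / (fps_exp 1 + 1)) $ n)
      = 2 * x ^ n"
    by (simp add: fps_numeral_fps_const)
  then show ?thesis
    by (simp add: euler_poly_def algebra_simps)
qed

text \<open>For \<open>A(t) = 2/(e^t + 1)\<close> one has \<open>A(t) + A(-t) = 2\<close>, so the
  even coefficients beyond the constant one vanish.\<close>

lemma euler_poly_0_even:
  assumes "even n" "n > 0"
  shows "euler_poly n (0 :: 'a::field_char_0) = 0"
proof -
  define A where "A = Abs_fps (\<lambda>n. euler_poly n (0::'a) / fact n)"
  define B where "B = A oo (- fps_X)"
  have A: "A * (fps_exp 1 + 1) = 2"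
    using euler_poly_generating_function[of "0::'a"] by (simp add: A_def)
  have "(A oo (- fps_X)) * ((fps_exp 1 + 1) oo (- fps_X)) = 2 oo (- fps_X)"
    unfolding A[symmetric] by (rule fps_compose_mult_distrib[symmetric]) simp
  then have "B * (fps_exp (- 1) + 1) = 2"
    by (simp add: B_def fps_compose_add_distrib)
  \<comment> \<open>Multiplying by \<open>e^t\<close> gives \<open>B\<close> the same denominator
    \<open>e^t + 1\<close> as \<open>A\<close>.\<close>
  then have "B * (fps_exp (- 1) + 1) * fps_exp 1 = 2 * fps_exp 1"
    by simp
  moreover have "fps_exp (- 1) * fps_exp 1 = (1 :: 'a fps)"
    by (simp flip: fps_exp_add_mult)
  then have "B * (fps_exp (- 1) + 1) * fps_exp 1 = B * (fps_exp 1 + 1)"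
    by (simp only: mult.assoc distrib_right mult_1_left add.commute)
  ultimately have "B * (fps_exp 1 + 1) = 2 * fps_exp 1"
    by simp
  then have "(A + B) * (fps_exp 1 + 1) = 2 * (fps_exp 1 + 1)"
    using A unfolding distrib_right[of A B] by (simp add: distrib_left)
  moreover have "fps_nth (fps_exp 1 + 1 :: 'a fps) 0 \<noteq> 0"
    by simp
  then have "(fps_exp 1 + 1 :: 'a fps) \<noteq> 0"
    by (metis fps_zero_nth)
  ultimately have "A + B = 2"
    by (metis mult_cancel_right)
  then have "A $ n + B $ n = 0"
    using \<open>n > 0\<close> by (metis fps_add_nth fps_numeral_nth less_irrefl)
  moreover have "B $ n = A $ n"
    using \<open>even n\<close> by (simp add: B_def fps_compose_uminus')
  ultimately show ?thesis
    by (simp add: A_def flip: mult_2)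
qed

subsection \<open>Telescoping\<close>

definition wp_term :: "'a::field_char_0 \<Rightarrow> nat \<Rightarrow> 'a" where
  "wp_term a k = (-1) ^ k * (2 * of_nat k + a) * (pochhammer a k / fact k) ^ 3"

text \<open>
  A Wilf--Zeilberger identity; it reflects that the full series
  \<open>\<Sum>\<^sub>k wp_term a k = sin (\<pi> a) / \<pi>\<close> changes sign under \<open>a \<mapsto> a + 1\<close>.
\<close>

lemma wp_term_telescope:
  fixes a :: "'a::field_char_0"
  shows "(\<Sum>k\<le>K. wp_term a k + wp_term (a + 1) k)
    = (-1) ^ K * (of_nat K + 1 + 2 * a) * (pochhammer (a + 1) K / fact K) ^ 3"
proof (induction K)
  case 0
  show ?case by (simp add: wp_term_def)
next
  case (Suc K)
  \<comment> \<open>Everything is expressed through \<open>z\<close>, \<open>k\<close> and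
    \<open>a\<close>, so that the induction step becomes an identity of rational functions.\<close>
  define z where "z = pochhammer (a + 1) K / fact K"
  define k where "k = (of_nat K + 1 :: 'a)"
  have k: "k \<noteq> 0" unfolding k_def by (metis of_nat_Suc of_nat_neq_0 add.commute)
  have 1: "pochhammer (a + 1) (Suc K) / fact (Suc K) = z * (a + k) / k"
    by (simp add: z_def k_def pochhammer_Suc add_ac mult_ac)
  have 2: "pochhammer a (Suc K) / fact (Suc K) = z * a / k"
    by (simp add: z_def k_def pochhammer_rec add_ac mult_ac)
  have 3: "of_nat (Suc K) = k" by (simp add: k_def)
  have "(\<Sum>k\<le>Suc K. wp_term a k + wp_term (a + 1) k)
      = (-1) ^ K * ((k + 2 * a) * z ^ 3 - (2 * k + a) * (z * a / k) ^ 3 - (2 * k + (a + 1)) * (z * (a + k) / k) ^ 3)"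
    unfolding sum.atMost_Suc Suc.IH unfolding wp_term_def 1 2 3 z_def[symmetric] k_def[symmetric]
    by (simp add: algebra_simps)
  also have "(k + 2 * a) * z ^ 3 - (2 * k + a) * (z * a / k) ^ 3 - (2 * k + (a + 1)) * (z * (a + k) / k) ^ 3
      = - ((k + 1 + 2 * a) * (z * (a + k) / k) ^ 3)"
    using k by (simp add: field_simps power3_eq_cube)
  finally show ?case
    unfolding 1 3 by simp
qed

text \<open>The telescoped sum up to \<open>j\<close> is completed by the single term of index
  \<open>j + 1\<close>. Since \<open>a = u - k\<close> with \<open>k = j + 1\<close>, all
  contributions of order below \<open>u^3\<close> cancel.\<close>

lemma wp_term_diagonal:
  fixes u :: "'a::field_char_0" and j :: nat
  defines "a \<equiv> u - of_nat (Suc j)"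
  shows "(\<Sum>k\<le>Suc j. wp_term a k) + (\<Sum>k\<le>j. wp_term (a + 1) k)
    = u ^ 3 * ((-1) ^ Suc j * (u - 2 * of_nat (Suc j)) * (pochhammer (a + 1) j / fact (Suc j)) ^ 3)"
proof -
  define z where "z = pochhammer (a + 1) j / fact (Suc j)"
  define k where "k = (of_nat (Suc j) :: 'a)"
  have k: "k \<noteq> 0" unfolding k_def by (rule of_nat_neq_0)
  have f: "fact (Suc j) = k * fact j" unfolding k_def by simp
  have 1: "pochhammer (a + 1) j / fact j = z * k"
    using k by (simp add: z_def f del: fact_Suc)
  have 2: "pochhammer a (Suc j) / fact (Suc j) = a * z"
    by (simp add: z_def pochhammer_rec del: fact_Suc)
  have 3: "of_nat j + 1 = k" by (simp add: k_def)
  have a: "a = u - k" by (simp add: a_def k_def)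
  have "(\<Sum>k\<le>Suc j. wp_term a k) + (\<Sum>k\<le>j. wp_term (a + 1) k)
      = (\<Sum>k\<le>j. wp_term a k + wp_term (a + 1) k) + wp_term a (Suc j)"
    by (simp add: sum.distrib)
  also have "\<dots> = (-1) ^ j * (k + 2 * a) * (z * k) ^ 3 - (-1) ^ j * (2 * k + a) * (a * z) ^ 3"
    unfolding wp_term_telescope unfolding wp_term_def 1 2 3 k_def[symmetric] by simp
  also have "\<dots> = u ^ 3 * ((-1) ^ Suc j * (u - 2 * k) * z ^ 3)"
  proof -
    have "(k + 2 * a) * (z * k) ^ 3 - (2 * k + a) * (a * z) ^ 3 = - (u ^ 3 * ((u - 2 * k) * z ^ 3))"
      unfolding a by (simp add: power3_eq_cube algebra_simps)
    then have "(-1) ^ j * ((k + 2 * a) * (z * k) ^ 3 - (2 * k + a) * (a * z) ^ 3)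
        = (-1) ^ j * - (u ^ 3 * ((u - 2 * k) * z ^ 3))"
      by (rule arg_cong)
    then show ?thesis by (simp add: mult_ac right_diff_distrib)
  qed
  finally show ?thesis by (simp only: z_def k_def)
qed

subsection \<open>The congruence\<close>

context rat_padic
begin

section \<open>Euler polynomial values at \<open>p\<close>-integral arguments\<close>

lemma not_pcong_0_uminus: "\<not> pcong m x 0 \<Longrightarrow> \<not> pcong m (- x) 0"
  using pcong_uminus[of m "- x" 0] by auto

text \<open>The addition formula with \<open>y = 1\<close> and the two-term relation express
  \<open>2 E_n(x)\<close> through \<open>x^n\<close> and lower \<open>E_k(x)\<close>; only 2 has to
  be inverted.\<close>

lemma Zp_euler_poly:
  assumes "2 < p" "x \<in> Zp"
  shows "euler_poly n x \<in> Zp"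
proof (induction n rule: less_induct)
  case (less n)
  define S where "S = (\<Sum>k<n. of_nat (n choose k) * euler_poly k x)"
  have S: "S \<in> Zp"
    unfolding S_def using less by auto
  have "euler_poly n (x + 1) = S + euler_poly n x"
    by (simp add: euler_poly_add S_def flip: lessThan_Suc_atMost)
  then have "2 * euler_poly n x = 2 * x ^ n - S"
    using euler_poly_plus_1[of n x] by simp
  then have "euler_poly n x = (2 * x ^ n - S) / 2"
    by simp
  moreover have "\<not> pcong 1 2 0"
    using not_pcong_0_of_nat[of 2] assms by simp
  ultimately show ?case
    using S assms by (simp only:) (intro Zp_divide Zp_diff Zp_mult Zp_power; simp)
qed

lemma pcong_euler_poly:
  assumes "2 < p" "pcong m x y" "y \<in> Zp"
  shows "pcong m (euler_poly n x) (euler_poly n y)"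
proof -
  have d: "pcong m (x - y) 0"
    using assms(2) pcong_diff_0_iff by blast
  \<comment> \<open>Taylor expansion at \<open>y\<close>. Since \<open>0 ^ 0 = 1\<close>, the second
    sum is the expansion of \<open>E_n(y + 0)\<close>.\<close>
  have "pcong m (\<Sum>k\<le>n. of_nat (n choose k) * euler_poly k y * (x - y) ^ (n - k))
      (\<Sum>k\<le>n. of_nat (n choose k) * euler_poly k y * 0 ^ (n - k))"
    using assms by (intro pcong_sum pcong_mult_left pcong_power d) (auto intro: Zp_euler_poly)
  then show ?thesis
    using euler_poly_add[of n y "x - y"] euler_poly_add[of n y 0] by simp
qed

section \<open>Recurrences modulo \<open>p^4\<close> for a general multiple \<open>u\<close> of
  \<open>p\<close>\<close>

context
  fixes c u :: rat
  assumes p_ge_5: "5 \<le> p" and c: "c \<in> Zp" and u: "u = of_nat p * c"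
begin

lemma p_gt_2: "2 < p"
  using p_ge_5 by simp

lemma odd_p: "odd p"
  using prime_p p_gt_2 prime_odd_nat by blast

lemma u_pcong_0: "pcong 1 u 0"
  unfolding u using c pcong_mult_right[OF c pcong_p] by simp

lemma pcong_u_minus: "pcong 1 (u - x) (- x)"
  using pcong_diff[OF u_pcong_0 pcong_refl, of x] by simp

text \<open>As \<open>p^3\<close> divides \<open>u^3\<close>, a cofactor of \<open>u^3\<close>
  matters only modulo \<open>p\<close>. All work modulo \<open>p^4\<close> is reduced to work modulo
  \<open>p\<close> in this way.\<close>

lemma pcong_lift_cube:
  assumes "pcong 1 x y"
  shows "pcong 4 (u ^ 3 * x) (u ^ 3 * y)"
  using pcong_raise[OF pcong_mult_left[OF Zp_power[OF c, of 3] assms], of 3]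
  by (simp add: u power_mult_distrib mult.assoc)

text \<open>\<open>F\<close> is abstract because both truncations use it. The term
  \<open>(-1)^m * u\<close> solves the homogeneous recurrence and carries the initial value; the
  Euler term is a particular solution that vanishes at \<open>m = 0\<close> modulo
  \<open>p^4\<close>.\<close>

lemma alternating_recurrence:
  fixes F :: "nat \<Rightarrow> rat"
  assumes "pcong 4 (F 0) u"
    and "\<And>j. Suc j < p \<Longrightarrow> pcong 4 (F (Suc j) + F j) (u ^ 3 * (2 / of_nat (Suc j) ^ 2))"
    and "m < p"
  shows "pcong 4 (F m) ((-1) ^ m * u + u ^ 3 * euler_poly (p - 3) (u - of_nat m))"
  using \<open>m < p\<close>
proof (induction m)
  case 0
  have "even (p - 3)" "0 < p - 3"
    using odd_p p_ge_5 by auto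
  then have "pcong 1 (euler_poly (p - 3) u) 0"
    using pcong_euler_poly[OF p_gt_2 u_pcong_0 Zp_0, of "p - 3"] by (simp add: euler_poly_0_even)
  from pcong_add[OF assms(1) pcong_sym[OF pcong_lift_cube[OF this]]] show ?case
    by simp
next
  case (Suc m)
  define x where "x = u - of_nat (Suc m)"
  define E where "E = (\<lambda>x :: rat. euler_poly (p - 3) x)"
  have "pcong 1 (x ^ (p - 3)) ((- of_nat (Suc m)) ^ (p - 3))"
    unfolding x_def by (intro pcong_power pcong_u_minus) auto
  \<comment> \<open>The exponent \<open>p - 3\<close> is even.\<close>
  also have "(- of_nat (Suc m) :: rat) ^ (p - 3) = of_nat (Suc m) ^ (p - 3)"
    using odd_p p_ge_5 by (simp add: uminus_power_if del: of_nat_Suc)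
  also have "pcong 1 (of_nat (Suc m) ^ (p - 3)) (1 / of_nat (Suc m) ^ 2)"
    using Suc.prems p_ge_5 by (intro fermat_inverse_square) auto
  finally have "pcong 1 (2 * x ^ (p - 3)) (2 * (1 / of_nat (Suc m) ^ 2))"
    by (rule pcong_mult_left[rotated]) simp
  from pcong_sym[OF pcong_lift_cube[OF this]]
  have "pcong 4 (u ^ 3 * (2 / of_nat (Suc m) ^ 2)) (u ^ 3 * (2 * x ^ (p - 3)))"
    by simp
  with assms(2)[OF Suc.prems]
  have "pcong 4 (F (Suc m) + F m) (u ^ 3 * (2 * x ^ (p - 3)))"
    by (rule pcong_trans)
  moreover have "E (x + 1) + E x = 2 * x ^ (p - 3)"
    unfolding E_def by (rule euler_poly_plus_1)
  moreover have "pcong 4 (F m) ((-1) ^ m * u + u ^ 3 * E (x + 1))"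
    using Suc by (simp add: x_def E_def)
  ultimately have "pcong 4 (F (Suc m) + F m - F m)
      (u ^ 3 * (E (x + 1) + E x) - ((-1) ^ m * u + u ^ 3 * E (x + 1)))"
    by (intro pcong_diff) auto
  then show ?case
    by (simp add: x_def E_def algebra_simps)
qed

lemma diagonal_sum_recurrence:
  assumes "Suc j < p"
  shows "pcong 4 ((\<Sum>k\<le>Suc j. wp_term (u - of_nat (Suc j)) k) + (\<Sum>k\<le>j. wp_term (u - of_nat j) k))
    (u ^ 3 * (2 / of_nat (Suc j) ^ 2))"
proof -
  define k where "k = (of_nat (Suc j) :: rat)"
  define Z where "Z = pochhammer (u - of_nat j) j"
  have k: "k \<noteq> 0" unfolding k_def by (rule of_nat_neq_0)
  have e: "u - of_nat (Suc j) + 1 = u - of_nat j" by simp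
  \<comment> \<open>Modulo \<open>p\<close> the argument becomes \<open>-j\<close>, and
    \<open>(-j)_j = (-1)^j j!\<close>.\<close>
  have Z: "pcong 1 Z ((-1) ^ j * fact j)"
    unfolding Z_def pochhammer_same[symmetric] by (intro pcong_pochhammer pcong_u_minus) auto
  have "pcong 1 (Z / fact (Suc j)) ((-1) ^ j * fact j / fact (Suc j))"
    using assms by (intro pcong_divide Z not_pcong_0_fact Zp_mult Zp_power Zp_uminus pcong_refl) auto
  also have "(-1) ^ j * fact j / fact (Suc j) = (-1) ^ j * (1 / k)"
    by (simp add: k_def)
  finally have q: "pcong 1 (Z / fact (Suc j)) ((-1) ^ j * (1 / k))" .
  have iZ: "1 / k \<in> Zp"
    using assms not_pcong_0_of_nat[of "Suc j"] unfolding k_def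
    by (intro Zp_divide) auto
  have "pcong 1 (u - 2 * k) (- (2 * k))"
    by (rule pcong_u_minus)
  then have "pcong 1 ((-1) ^ Suc j * (u - 2 * k) * (Z / fact (Suc j)) ^ 3)
      ((-1) ^ Suc j * (- (2 * k)) * ((-1) ^ j * (1 / k)) ^ 3)"
    using iZ q by (intro pcong_mult pcong_power pcong_refl Zp_mult Zp_power Zp_uminus)
      (auto simp: k_def simp del: of_nat_Suc)
  also have "(-1) ^ Suc j * (- (2 * k)) * ((-1) ^ j * (1 / k)) ^ 3 = 2 / k ^ 2"
    using k by (simp add: power_mult_distrib field_simps power3_eq_cube power2_eq_square flip: power_mult power_add)
  finally show ?thesis
    using pcong_lift_cube wp_term_diagonal[of u j] by (simp only: e Z_def k_def)
qed

text \<open>Of the \<open>p\<close> consecutive factors, \<open>u\<close> is the one divisible by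
  \<open>p\<close>; the others run through the nonzero residues. Increasing \<open>m\<close>
  replaces the factor \<open>a + p\<close> by \<open>a\<close>, a unit with the same residue. The
  value \<open>(p - 1)!\<close> is kept because it cancels later.\<close>

lemma pochhammer_p_block:
  assumes "m < p"
  shows "\<exists>w. pochhammer (u - of_nat m) p = u * w \<and> pcong 1 w (fact (p - 1))"
  using assms
proof (induction m)
  case 0
  have "pcong 1 (u + 1) (0 + 1)"
    by (intro pcong_add u_pcong_0 pcong_refl)
  then have "pcong 1 (pochhammer (u + 1) (p - 1)) (fact (p - 1))"
    unfolding pochhammer_fact by (intro pcong_pochhammer) auto
  moreover have "pochhammer u p = u * pochhammer (u + 1) (p - 1)"
    using pochhammer_rec[of u "p - 1"] p_gt_2 by (simp add: Suc_diff_1)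
  ultimately show ?case by auto
next
  case (Suc m)
  then obtain w where w: "pochhammer (u - of_nat m) p = u * w" and wc: "pcong 1 w (fact (p - 1))"
    by auto
  define a where "a = u - of_nat (Suc m)"
  define k where "k = (of_nat (Suc m) :: rat)"
  have k: "\<not> pcong 1 (- k) 0" "k \<noteq> 0"
    unfolding k_def using Suc.prems not_pcong_0_uminus[OF not_pcong_0_of_nat[of "Suc m"]] by auto
  have a: "pcong 1 a (- k)"
    unfolding a_def k_def by (rule pcong_u_minus)
  have ap: "pcong 1 (a + of_nat p) (- k)"
    using pcong_add[OF a pcong_p] by simp
  have "a + of_nat p \<noteq> 0"
    using ap k pcong_sym by force
  moreover have "a + 1 = u - of_nat m"
    by (simp add: a_def)
  then have "pochhammer a p * (a + of_nat p) = a * (u * w)"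
    using pochhammer_Suc[of a p] pochhammer_rec[of a p] w by simp
  ultimately have "pochhammer a p = u * (w * a / (a + of_nat p))"
    by (simp add: field_simps)
  moreover have "pcong 1 (w * a / (a + of_nat p)) (fact (p - 1) * (- k) / (- k))"
    using k a ap wc by (intro pcong_divide pcong_mult) (auto simp: k_def)
  then have "pcong 1 (w * a / (a + of_nat p)) (fact (p - 1))"
    using k by simp
  ultimately show ?case unfolding a_def by blast
qed

text \<open>In the closed form at \<open>K = p - 1\<close>, the factor
  \<open>(a + 1)_(p-1) = (a)_p / a\<close> is a multiple of \<open>u\<close>, so its cube supplies
  \<open>u^3\<close>. The cofactor reduces to \<open>2(-k)(-1/k)^3\<close>.\<close>

lemma full_sum_recurrence:
  assumes "Suc j < p"
  shows "pcong 4 ((\<Sum>k\<le>p - 1. wp_term (u - of_nat (Suc j)) k) + (\<Sum>k\<le>p - 1. wp_term (u - of_nat j) k))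
    (u ^ 3 * (2 / of_nat (Suc j) ^ 2))"
proof -
  define a where "a = u - of_nat (Suc j)"
  define k where "k = (of_nat (Suc j) :: rat)"
  define f where "f = (fact (p - 1) :: rat)"
  obtain w where w: "pochhammer a p = u * w" and wc: "pcong 1 w f"
    using pochhammer_p_block[OF assms] unfolding a_def f_def by blast
  have k: "\<not> pcong 1 (- k) 0" "k \<noteq> 0"
    unfolding k_def using assms not_pcong_0_uminus[OF not_pcong_0_of_nat[of "Suc j"]] by auto
  have f: "\<not> pcong 1 f 0" "f \<in> Zp" "f \<noteq> 0"
    unfolding f_def using p_gt_2 not_pcong_0_fact[of "p - 1"] by auto
  have a: "pcong 1 a (- k)"
    unfolding a_def k_def by (rule pcong_u_minus)
  then have "a \<noteq> 0" using k pcong_sym by force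
  have a1: "a + 1 = u - of_nat j" by (simp add: a_def)
  have "pochhammer a p = a * pochhammer (a + 1) (p - 1)"
    using pochhammer_rec[of a "p - 1"] p_gt_2 by (simp add: Suc_diff_1)
  then have P: "pochhammer (a + 1) (p - 1) = u * (w / a)"
    using w \<open>a \<noteq> 0\<close> by (simp add: field_simps)
  have "(\<Sum>k\<le>p - 1. wp_term a k) + (\<Sum>k\<le>p - 1. wp_term (a + 1) k)
      = (-1) ^ (p - 1) * (of_nat (p - 1) + 1 + 2 * a) * (u * (w / a) / f) ^ 3"
    unfolding sum.distrib[symmetric] wp_term_telescope P f_def ..
  also have "\<dots> = u ^ 3 * ((of_nat p + 2 * a) * (w / f / a) ^ 3)"
    using odd_p p_gt_2 by (simp add: of_nat_diff power_mult_distrib power_divide mult_ac)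
  also have "pcong 4 \<dots> (u ^ 3 * ((0 + 2 * - k) * (f / f / - k) ^ 3))"
    using k f a wc
    by (intro pcong_lift_cube pcong_mult pcong_add pcong_p pcong_mult_left pcong_power pcong_divide)
      (auto simp: k_def intro!: Zp_divide)
  also have "(0 + 2 * - k) * (f / f / - k) ^ 3 = 2 / k ^ 2"
    using k f by (simp add: field_simps power3_eq_cube power2_eq_square)
  finally show ?thesis unfolding a1 by (simp only: a_def k_def)
qed

text \<open>Initial value for the sums up to \<open>p - 1\<close>. The term \<open>k = 0\<close> is
  \<open>u\<close>; every later one contains \<open>u^3\<close>, with cofactor
  \<open>2(-1)^k/k^2\<close> modulo \<open>p\<close>, and these cofactors sum to 0 modulo
  \<open>p\<close>.\<close>

lemma full_sum_0: "pcong 4 (\<Sum>k\<le>p - 1. wp_term u k) u"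
proof -
  have t: "pcong 4 (wp_term u k) (u ^ 3 * (2 * ((-1) ^ k / of_nat k ^ 2)))" if k: "k \<in> {0<..<p}" for k
  proof -
    obtain j where j: "k = Suc j" using k by (cases k) auto
    have f: "\<not> pcong 1 (fact k) 0" using k not_pcong_0_fact by simp
    have "wp_term u k = u ^ 3 * ((-1) ^ k * ((u + 2 * of_nat k) * (pochhammer (u + 1) j / fact k) ^ 3))"
      unfolding wp_term_def j pochhammer_rec
      by (simp add: power_mult_distrib power_divide mult_ac add_ac del: fact_Suc of_nat_Suc power_Suc)
    also have "pcong 4 \<dots> (u ^ 3 * ((-1) ^ k * ((0 + 2 * of_nat k) * (pochhammer (0 + 1) j / fact k) ^ 3)))"
      using f
      by (intro pcong_lift_cube pcong_mult_left[of "(-1) ^ k"] pcong_mult pcong_power pcong_divide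
          pcong_pochhammer pcong_add u_pcong_0 pcong_refl)
        (auto intro!: Zp_divide simp flip: pochhammer_fact)
    also have "(-1) ^ k * ((0 + 2 * of_nat k) * (pochhammer (0 + 1) j / fact k) ^ 3)
        = (2 * ((-1) ^ k / of_nat k ^ 2) :: rat)"
      unfolding j by (simp add: power_divide power_mult_distrib power3_eq_cube power2_eq_square
          del: of_nat_Suc flip: pochhammer_fact)
    finally show ?thesis .
  qed
  have "{..p - 1} = insert 0 {0<..<p}" using p_gt_2 by auto
  then have "(\<Sum>k\<le>p - 1. wp_term u k) = u + (\<Sum>k\<in>{0<..<p}. wp_term u k)"
    by (simp add: wp_term_def)
  also have "pcong 4 \<dots> (u + (\<Sum>k\<in>{0<..<p}. u ^ 3 * (2 * ((-1) ^ k / of_nat k ^ 2))))"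
    by (intro pcong_add pcong_sum t pcong_refl)
  also have "\<dots> = u + u ^ 3 * (2 * (\<Sum>k\<in>{0<..<p}. (-1) ^ k / of_nat k ^ 2))"
    by (simp add: sum_distrib_left)
  also have "pcong 4 \<dots> (u + u ^ 3 * (2 * 0))"
    by (intro pcong_add pcong_refl pcong_lift_cube pcong_mult_left alternating_inverse_square_sum odd_p) simp
  finally show ?thesis by simp
qed

text \<open>For \<open>M = n\<close> the upper limit moves with the shift \<open>m\<close>, so the
  initial sum is the single term \<open>u\<close>; for \<open>M = p - 1\<close> the limit stays
  fixed.\<close>

lemma truncated_sum:
  assumes "n < p" "M = n \<or> M = p - 1"
  shows "pcong 4 (\<Sum>k\<le>M. wp_term (u - of_nat n) k)
    ((-1) ^ n * u + u ^ 3 * euler_poly (p - 3) (u - of_nat n))"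
  using assms(2)
proof
  assume "M = n"
  then show ?thesis
    using alternating_recurrence[of "\<lambda>m. \<Sum>k\<le>m. wp_term (u - of_nat m) k" n]
      diagonal_sum_recurrence assms(1) by (simp add: wp_term_def)
next
  assume "M = p - 1"
  then show ?thesis
    using alternating_recurrence[of "\<lambda>m. \<Sum>k\<le>p - 1. wp_term (u - of_nat m) k" n]
      full_sum_recurrence full_sum_0 assms(1) by simp
qed

end

end

theorem theorem1p3:
  fixes p M :: nat
  assumes "prime p" and "odd p" and "[p = 2] (mod 3)"
    and "M = (2 * p - 1) div 3 \<or> M = p - 1"
  shows "rat_cong_ppow p 4
           (\<Sum>k=0..M. (-1) ^ k * of_nat (6 * k + 1) * pochhammer (1/3) k ^ 3 / fact k ^ 3)
           (- 2 * of_nat p + 8 * of_nat p ^ 3 / 9 * euler_poly (p - 3) (1/3))"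
proof -
  interpret rat_padic p by unfold_locales fact
  have m3: "p mod 3 = 2" using assms(3) by (simp add: cong_def)
  have p5: "5 \<le> p"
  proof (rule ccontr)
    assume "\<not> 5 \<le> p"
    then have "p = 0 \<or> p = 1 \<or> p = 2 \<or> p = 3 \<or> p = 4" by linarith
    then show False using m3 assms(2) by auto
  qed
  define n where "n = (2 * p - 1) div 3"
  \<comment> \<open>Writing \<open>p = 3l + 2\<close> gives \<open>n = 2l + 1\<close>: the division
    is exact and \<open>n\<close> is odd.\<close>
  have n: "3 * n + 1 = 2 * p" using m3 p5 unfolding n_def by presburger
  then have "n < p" "odd n" using p5 by presburger+
  have three: "\<not> pcong 1 3 0"
    using not_pcong_0_of_nat[of 3] p5 by simp
  \<comment> \<open>Chosen so that \<open>u - n = 1/3\<close>. Then \<open>3 * (-u) = -2p\<close>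
    and \<open>3 * u^3 = 8p^3/9\<close> are the coefficients in the claim.\<close>
  define u :: rat where "u = of_nat p * (2 / 3)"
  have "(of_nat (3 * n + 1) :: rat) = of_nat (2 * p)" using n by (rule arg_cong)
  then have un: "u - of_nat n = 1 / 3" by (simp add: u_def field_simps)
  have third: "1 / 3 \<in> Zp" using three by (intro Zp_divide) auto
  let ?S = "\<Sum>k=0..M. (-1) ^ k * of_nat (6 * k + 1) * pochhammer (1/3) k ^ 3 / fact k ^ 3 :: rat"
  let ?R = "- 2 * of_nat p + 8 * of_nat p ^ 3 / 9 * euler_poly (p - 3) (1/3) :: rat"
  have "pcong 4 (\<Sum>k\<le>M. wp_term (1 / 3) k) ((-1) ^ n * u + u ^ 3 * euler_poly (p - 3) (1 / 3))"
    using truncated_sum[OF p5 _ u_def \<open>n < p\<close>, of M] assms(4) three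
    by (simp add: un Zp_divide flip: n_def)
  then have "pcong 4 (3 * (\<Sum>k\<le>M. wp_term (1 / 3) k))
      (3 * ((-1) ^ n * u + u ^ 3 * euler_poly (p - 3) (1 / 3)))"
    by (intro pcong_mult_left) auto
  \<comment> \<open>The factor 3 clears the linear factor:
    \<open>3(2k + 1/3) = 6k + 1\<close>.\<close>
  moreover have "3 * (\<Sum>k\<le>M. wp_term (1 / 3) k) = ?S"
    unfolding sum_distrib_left atLeast0AtMost
    by (intro sum.cong refl) (simp add: wp_term_def power_divide field_simps)
  moreover have "3 * ((-1) ^ n * u + u ^ 3 * euler_poly (p - 3) (1 / 3)) = ?R"
    using \<open>odd n\<close> by (simp add: u_def power_mult_distrib power3_eq_cube)
  ultimately have SR: "pcong 4 ?S ?R" by simp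
  \<comment> \<open>Splitting \<open>1/9\<close> reduces integrality to that of
    \<open>1/3\<close>.\<close>
  have "8 * of_nat p ^ 3 / 9 = (8 * of_nat p ^ 3 * (1 / 3) * (1 / 3) :: rat)"
    by simp
  then have R: "?R \<in> Zp"
    using third p5 by (simp only:) (intro Zp_add Zp_mult Zp_uminus Zp_power Zp_euler_poly; simp)
  with SR show ?thesis
    unfolding rat_cong_ppow_def using pcong_Zp[OF SR R] SR by (simp add: pcong_def)
qed

end
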